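(* Let $q : E\to B$ be a fibration with nonempty path-connected fiber, where $E$ is path-connected, and let $n\ge 1$. Then $\mathrm{TC}_n[q : E\to B]\le \mathrm{TC}_n(E)$.
   Context: For continuous maps $f_1,\dots,f_m : W\to V$, the higher homotopic distance $\mathrm{D}(f_1,\dots,f_m)$ is the least positive integer $r$ such that $W$ has an open cover $\{W_1,\dots,W_r\}$ with $f_1|_{W_i}\simeq f_2|_{W_i}\simeq\cdots\simeq f_m|_{W_i}$ (as maps $W_i\to V$) for every $i$ (and $\infty$ if no such $r$ exists); for a single map ($m=1$) it is $1$. The higher topological complexity of a path-connected space $E$ is $\mathrm{TC}_n(E)=\mathrm{D}(p_1,\dots,p_n)$, where $p_i : E^{n}\to E$ is the projection onto the $i$-th factor. For a fibration $q : E\to B$ with nonempty path-connected fiber, let $E\times_B\cdots\times_B E=\{(e_1,\dots,e_n)\in E^{n} : q(e_1)=\cdots=q(e_n)\}$ and let $p_i^{B} : E\times_B\cdots\times_B E\to E$ be the projection onto the $i$-th factor. The parametrised higher topological complexity (homotopic distance definition) is $\mathrm{TC}_n[q : E\to B]=\mathrm{D}(p_1^{B},\dots,p_n^{B})$ for $n>1$, and $\mathrm{TC}_1[q : E\to B]=1$. *)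

theory Defs
  imports "HOL-Analysis.Analysis"
begin

definition homotopy_lifting_property ::
    "'c topology \<Rightarrow> 'e topology \<Rightarrow> 'b topology \<Rightarrow> ('e \<Rightarrow> 'b) \<Rightarrow> bool" where
  "homotopy_lifting_property X E B q \<longleftrightarrow>
     (\<forall>f h. continuous_map X E f \<and>
        continuous_map (prod_topology (top_of_set {0..1::real}) X) B h \<and>
        (\<forall>x\<in>topspace X. h (0, x) = q (f x)) \<longrightarrow>
        (\<exists>k. continuous_map (prod_topology (top_of_set {0..1::real}) X) E k \<and>
           (\<forall>x\<in>topspace X. k (0, x) = f x) \<and>
           (\<forall>t\<in>{0..1}. \<forall>x\<in>topspace X. q (k (t, x)) = h (t, x))))"

text \<open>
  Hurewicz fibrations.  A definition cannot quantify over spaces on all types, so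
  the spaces range over the topologies on one type that is large enough to carry
  the mapping path space of \<open>q\<close>.  Lemma \<open>fibration_imp_homotopy_lifting_property\<close> shows
  that the lifting property then holds for spaces on every type.
\<close>

definition fibration :: "'e topology \<Rightarrow> 'b topology \<Rightarrow> ('e \<Rightarrow> 'b) \<Rightarrow> bool" where
  "fibration E B q \<longleftrightarrow> continuous_map E B q \<and>
     (\<forall>X :: ('e \<times> (real \<Rightarrow> 'b)) topology. homotopy_lifting_property X E B q)"

lemma quotient_topology_exists:
  fixes g :: "'a \<Rightarrow> 'c"
  obtains Y :: "'c topology" where "quotient_map X Y g"
proof -
  define P where "P = (\<lambda>U. U \<subseteq> g ` topspace X \<and> openin X {x \<in> topspace X. g x \<in> U})"
  have "istopology P"
    unfolding istopology_def
  proof (intro conjI allI impI)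
    fix S T assume "P S" "P T"
    moreover have "{x \<in> topspace X. g x \<in> S \<inter> T} =
        {x \<in> topspace X. g x \<in> S} \<inter> {x \<in> topspace X. g x \<in> T}" by auto
    ultimately show "P (S \<inter> T)" by (auto simp: P_def)
  next
    fix K assume K: "\<forall>S\<in>K. P S"
    have "{x \<in> topspace X. g x \<in> \<Union>K} = (\<Union>S\<in>K. {x \<in> topspace X. g x \<in> S})" by auto
    moreover have "openin X (\<Union>S\<in>K. {x \<in> topspace X. g x \<in> S})"
      using K by (intro openin_Union) (auto simp: P_def)
    ultimately show "P (\<Union>K)" using K unfolding P_def by (simp add: Sup_least)
  qed
  then have op: "openin (topology P) U \<longleftrightarrow> P U" for U
    by (simp add: topology_inverse')
  have "P (g ` topspace X)"
  proof -
    have "{x \<in> topspace X. g x \<in> g ` topspace X} = topspace X" by auto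
    then show ?thesis by (simp add: P_def)
  qed
  then have "g ` topspace X \<subseteq> topspace (topology P)"
    using op openin_subset by blast
  moreover have "topspace (topology P) \<subseteq> g ` topspace X"
    using op[of "topspace (topology P)"] by (simp add: P_def)
  ultimately have "topspace (topology P) = g ` topspace X"
    by (rule subset_antisym[rotated])
  then have "quotient_map X (topology P) g"
    unfolding quotient_map_def op by (simp add: P_def)
  then show thesis by (rule that)
qed

lemma fibration_imp_homotopy_lifting_property:
  fixes X :: "'c topology" and E :: "'e topology" and B :: "'b topology"
  assumes "fibration E B q"
  shows "homotopy_lifting_property X E B q"
  unfolding homotopy_lifting_property_def
proof (intro allI impI, elim conjE)
  fix f h
  let ?I = "top_of_set {0..1::real}"
  assume f: "continuous_map X E f"
    and h: "continuous_map (prod_topology ?I X) B h"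
    and 0: "\<forall>x\<in>topspace X. h (0, x) = q (f x)"
  define g where "g = (\<lambda>x. (f x, \<lambda>t. h (t, x)))"
  obtain Y :: "('e \<times> (real \<Rightarrow> 'b)) topology" where Y: "quotient_map X Y g"
    by (rule quotient_topology_exists)
  have surj: "g ` topspace X = topspace Y"
    using Y by (rule quotient_imp_surjective_map)
  have "compact_space ?I"
    by (simp add: compact_space_subtopology)
  then have "locally_compact_space ?I"
    by (intro compact_imp_locally_compact_space)
  moreover have "Hausdorff_space ?I"
    by (simp add: Hausdorff_space_subtopology)
  ultimately have IY: "quotient_map (prod_topology ?I X) (prod_topology ?I Y) (\<lambda>(t, x). (t, g x))"
    using Y by (intro quotient_map_prod_right disjI1)
  have f': "continuous_map Y E fst"
    by (rule continuous_compose_quotient_map[OF Y]) (use f in \<open>simp add: g_def o_def\<close>)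
  have h': "continuous_map (prod_topology ?I Y) B (\<lambda>(t, y). snd y t)"
  proof (rule continuous_compose_quotient_map[OF IY])
    show "continuous_map (prod_topology ?I X) B ((\<lambda>(t, y). snd y t) \<circ> (\<lambda>(t, x). (t, g x)))"
      using h by (simp add: g_def o_def split_def)
  qed
  have "\<forall>y\<in>topspace Y. (\<lambda>(t, y). snd y t) (0::real, y) = q (fst y)"
    using 0 by (auto simp: surj[symmetric] g_def)
  moreover have "homotopy_lifting_property Y E B q"
    using assms by (simp add: fibration_def)
  ultimately obtain k where k: "continuous_map (prod_topology ?I Y) E k"
      "\<forall>y\<in>topspace Y. k (0, y) = fst y"
      "\<forall>t\<in>{0..1}. \<forall>y\<in>topspace Y. q (k (t, y)) = (\<lambda>(t, y). snd y t) (t, y)"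
    using f' h' unfolding homotopy_lifting_property_def by blast
  show "\<exists>k. continuous_map (prod_topology ?I X) E k \<and>
           (\<forall>x\<in>topspace X. k (0, x) = f x) \<and>
           (\<forall>t\<in>{0..1}. \<forall>x\<in>topspace X. q (k (t, x)) = h (t, x))"
  proof (intro exI conjI ballI)
    show "continuous_map (prod_topology ?I X) E (k \<circ> (\<lambda>(t, x). (t, g x)))"
      using continuous_map_compose[OF quotient_imp_continuous_map[OF IY] k(1)] .
  qed (use k(2,3) in \<open>auto simp: surj[symmetric] g_def\<close>)
qed

text \<open>
  The homotopic distance of \<open>f 1, \<dots>, f m\<close>; it is \<open>\<infinity> = Inf {}\<close> if there is
  no suitable open cover.
\<close>

definition homotopic_distance ::
    "'w topology \<Rightarrow> 'v topology \<Rightarrow> nat \<Rightarrow> (nat \<Rightarrow> 'w \<Rightarrow> 'v) \<Rightarrow> enat" where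
  "homotopic_distance W V m f =
     (if m = 1 then 1
      else Inf {enat r | r. 1 \<le> r \<and>
        (\<exists>U :: nat \<Rightarrow> 'w set.
           (\<forall>i\<in>{1..r}. openin W (U i)) \<and> (\<Union>i\<in>{1..r}. U i) = topspace W \<and>
           (\<forall>i\<in>{1..r}. \<forall>j\<in>{1..<m}.
              homotopic_with (\<lambda>_. True) (subtopology W (U i)) V (f j) (f (Suc j))))})"

definition higher_TC :: "nat \<Rightarrow> 'e topology \<Rightarrow> enat" where
  "higher_TC n E =
     homotopic_distance (product_topology (\<lambda>_. E) {1..n}) E n (\<lambda>i e. e i)"

definition fibre_power :: "nat \<Rightarrow> 'e topology \<Rightarrow> ('e \<Rightarrow> 'b) \<Rightarrow> (nat \<Rightarrow> 'e) topology" where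
  "fibre_power n E q =
     subtopology (product_topology (\<lambda>_. E) {1..n})
       {e. \<forall>i\<in>{1..n}. \<forall>j\<in>{1..n}. q (e i) = q (e j)}"

text \<open>
  The homotopies between the projections take values in \<open>E\<close> and are not required
  to be fibrewise.  The base is determined by \<open>q\<close> and does not enter the value.
\<close>

definition parametrised_higher_TC :: "nat \<Rightarrow> 'e topology \<Rightarrow> ('e \<Rightarrow> 'b) \<Rightarrow> enat" where
  "parametrised_higher_TC n E q =
     (if n = 1 then 1 else homotopic_distance (fibre_power n E q) E n (\<lambda>i e. e i))"

end

theory Submission
  imports Defs
begin

text \<open>The fibre power is a subspace of \<open>E\<close>^n, and its projections are the
  restrictions of those of \<open>E\<close>^n. Homotopic distance cannot grow on a subspace: an open
  cover of the whole space on whose members the maps are homotopic restricts to such a cover of the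
  subspace, with the same number of members. This is
  \<open>homotopic_distance_subtopology_le\<close>.\<close>

lemma homotopic_distance_subtopology_le:
  "homotopic_distance (subtopology W S) V m f \<le> homotopic_distance W V m f"
proof (cases "m = 1")
  case False
  have "\<exists>U'. (\<forall>i\<in>{1..r}. openin (subtopology W S) (U' i)) \<and>
      (\<Union>i\<in>{1..r}. U' i) = topspace (subtopology W S) \<and>
      (\<forall>i\<in>{1..r}. \<forall>j\<in>{1..<m}.
        homotopic_with (\<lambda>_. True) (subtopology (subtopology W S) (U' i)) V (f j) (f (Suc j)))"
    if "\<forall>i\<in>{1..r}. openin W (U i)" "(\<Union>i\<in>{1..r}. U i) = topspace W"
      and hom: "\<forall>i\<in>{1..r}. \<forall>j\<in>{1..<m}.
        homotopic_with (\<lambda>_. True) (subtopology W (U i)) V (f j) (f (Suc j))"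
    for r :: nat and U
  proof (intro exI[of _ "\<lambda>i. U i \<inter> S"] conjI ballI)
    fix i j assume "i \<in> {1..r}" "j \<in> {1..<m}"
    then have "homotopic_with (\<lambda>_. True) (subtopology (subtopology W (U i)) S) V (f j) (f (Suc j))"
      using hom by (blast intro: homotopic_from_subtopology)
    \<comment> \<open>Restricting to \<open>S\<close> and to \<open>U i\<close> commutes, so a
      homotopy on \<open>U i\<close> cut down to \<open>S\<close> lives on the member of the new
      cover.\<close>
    moreover have "subtopology (subtopology W S) (U i \<inter> S) = subtopology (subtopology W (U i)) S"
      by (simp add: subtopology_subtopology Int_ac)
    ultimately show "homotopic_with (\<lambda>_. True) (subtopology (subtopology W S) (U i \<inter> S)) V
        (f j) (f (Suc j))"
      by simp
  qed (use that in \<open>auto intro: openin_subtopology_Int\<close>)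
  then show ?thesis
    \<comment> \<open>Every \<open>r\<close> admissible for \<open>W\<close> is admissible for the
      subspace, and the infimum over a larger set is smaller.\<close>
    using False unfolding homotopic_distance_def by (auto intro!: Inf_superset_mono)
qed (simp add: homotopic_distance_def)

theorem proposition5p4:
  fixes E :: "'e topology" and B :: "'b topology" and q :: "'e \<Rightarrow> 'b" and n :: nat
  assumes "fibration E B q"
    and "\<And>b. b \<in> topspace B \<Longrightarrow> {e \<in> topspace E. q e = b} \<noteq> {}"
    and "\<And>b. b \<in> topspace B \<Longrightarrow> path_connected_space (subtopology E {e \<in> topspace E. q e = b})"
    and "path_connected_space E"
    and "n \<ge> 1"
  shows "parametrised_higher_TC n E q \<le> higher_TC n E"
  using homotopic_distance_subtopology_le
  \<comment> \<open>The instance at \<open>Suc 0\<close> settles \<open>n = 1\<close>, where both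
    sides are 1 by convention.\<close>
  by (auto simp: parametrised_higher_TC_def higher_TC_def fibre_power_def homotopic_distance_def[of _ _ "Suc 0"])

end
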